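(* Let $\psi\in(0,1)$, $\phi>0$ with $\phi\psi^{-1}<1$, and $\sigma^2>0$. For a probability measure $B$ supported on $\mathbb R_{>0}$, let $\tilde c_0=\tilde c_0(\phi,\psi,B)$ be the unique negative solution of $1=\psi\int\frac{x}{-\tilde c_0+x\phi}\,dB(x)$, and let $$\mathcal V(B)=\sigma^2\,\frac{\psi\displaystyle\int\frac{x^2\phi}{(\tilde c_0-x\phi)^2}\,dB(x)}{1-\psi\displaystyle\int\frac{x^2\phi}{(\tilde c_0-x\phi)^2}\,dB(x)}.$$ Then taking $B=\delta_a$ for some $a>0$ (which corresponds to orthogonal sketching) minimizes $\mathcal V(B)$ among all probability measures $B$ supported on $\mathbb R_{>0}$; that is, $\mathcal V(\delta_a)\le\mathcal V(B)$ for every such $B$. Therefore it minimizes the limiting risks.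
   Context: $\delta_a$ denotes the Dirac measure at $a$. In the linear model $Y=X\beta+E$ with sketching matrix $S\in\mathbb R^{m\times n}$, $p/n\to\phi$, $m/n\to\psi$, $B$ is the limiting spectral distribution of $SS^\top$, and $\mathcal V(B)$ is the limiting variance, and also the limiting out-of-sample prediction risk (the limiting bias being zero), of the sketched ridgeless least square estimator $\hat\beta^S=(X^\top S^\top SX)^+X^\top S^\top SY$ in the underparameterized regime $\phi\psi^{-1}<1$, where $\sigma^2$ is the noise variance. Orthogonal sketching means $SS^\top=I_m$. *)

theory Defs
  imports "HOL-Probability.Probability" "HOL-Real_Asymp.Real_Asymp" "Jordan_Normal_Form.Char_Poly"
begin

section \<open>The limiting variance as a functional of the spectral law\<close>

text \<open>``Supported on the positive half-line'' means that the complement has measure zero; the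
  topological support may still contain 0.\<close>

definition positive_law :: "real measure \<Rightarrow> bool" where
  "positive_law B \<longleftrightarrow> real_distribution B \<and> (AE x in B. 0 < x)"

definition c0 :: "real \<Rightarrow> real \<Rightarrow> real measure \<Rightarrow> real" where
  "c0 \<phi> \<psi> B = (THE c. c < 0 \<and> 1 = \<psi> * (\<integral>x. x / (- c + x * \<phi>) \<partial>B))"

definition limiting_variance :: "real \<Rightarrow> real \<Rightarrow> real \<Rightarrow> real measure \<Rightarrow> real" where
  "limiting_variance \<phi> \<psi> \<sigma> B =
    \<sigma>\<^sup>2 * ((\<psi> * (\<integral>x. x\<^sup>2 * \<phi> / (c0 \<phi> \<psi> B - x * \<phi>)\<^sup>2 \<partial>B)) /
         (1 - \<psi> * (\<integral>x. x\<^sup>2 * \<phi> / (c0 \<phi> \<psi> B - x * \<phi>)\<^sup>2 \<partial>B)))"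

lemma c0_ex1:
  fixes \<phi> \<psi> :: real
  assumes "0 < \<psi>" "0 < \<phi>" "\<phi> * inverse \<psi> < 1" "positive_law B"
  shows "\<exists>!c. c < 0 \<and> 1 = \<psi> * (\<integral>x. x / (- c + x * \<phi>) \<partial>B)"
proof -
  interpret real_distribution B using assms(4) by (simp add: positive_law_def)
  have pos: "AE x in B. 0 < x" using assms(4) by (simp add: positive_law_def)
  define f where "f t = (\<integral>x. x / (t + x * \<phi>) \<partial>B)" for t
  have meas [measurable]: "(\<lambda>x. x / (t + x * \<phi>)) \<in> borel_measurable B" for t
    by measurable
  have bd: "AE x in B. norm (x / (t + x * \<phi>)) \<le> 1 / \<phi>" if "0 \<le> t" for t
    using pos
  proof eventually_elim
    case (elim x)
    then have "0 < t + x * \<phi>" using assms(2) that by (simp add: add_nonneg_pos)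
    then show ?case using elim assms(2) that by (simp add: field_simps)
  qed
  have int: "integrable B (\<lambda>x. x / (t + x * \<phi>))" if "0 \<le> t" for t
    using integrable_const_bound[OF bd[OF that] meas] .
  have lim: "(\<lambda>n. f (s n)) \<longlonglongrightarrow> f t" if "0 \<le> t" "\<And>n. 0 \<le> s n" "s \<longlonglongrightarrow> t" for s t
    unfolding f_def
  proof (rule integral_dominated_convergence[where w = "\<lambda>_. 1 / \<phi>"])
    show "AE x in B. (\<lambda>n. x / (s n + x * \<phi>)) \<longlonglongrightarrow> x / (t + x * \<phi>)"
      using pos
    proof eventually_elim
      case (elim x)
      then have "0 < t + x * \<phi>" using assms(2) that by (simp add: add_nonneg_pos)
      then show ?case by (intro tendsto_intros that) simp
    qed
    show "AE x in B. norm (x / (s n + x * \<phi>)) \<le> 1 / \<phi>" for n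
      using bd[OF that(2)] .
  qed auto
  have cont: "continuous_on {0..u} f" for u
    unfolding continuous_on_sequentially
    using lim by (auto simp: o_def)
  have f0: "f 0 = 1 / \<phi>"
  proof -
    have "f 0 = (\<integral>x. 1 / \<phi> \<partial>B)"
      unfolding f_def using pos assms(2) by (intro integral_cong_AE) (auto elim!: eventually_mono)
    then show ?thesis using prob_space by simp
  qed
  have lim0: "(\<lambda>n. f (real n)) \<longlonglongrightarrow> 0"
  proof -
    have "(\<lambda>n. \<integral>x. x / (real n + x * \<phi>) \<partial>B) \<longlonglongrightarrow> (\<integral>x. 0 \<partial>B)"
    proof (rule integral_dominated_convergence[where w = "\<lambda>_. 1 / \<phi>"])
      show "AE x in B. (\<lambda>n. x / (real n + x * \<phi>)) \<longlonglongrightarrow> 0"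
        by (intro AE_I2) real_asymp
      show "AE x in B. norm (x / (real n + x * \<phi>)) \<le> 1 / \<phi>" for n
        using bd[of "real n"] by simp
    qed auto
    then show ?thesis by (simp add: f_def)
  qed
  have "\<phi> < \<psi>" using assms by (simp add: field_simps)
  then have f0': "1 / \<psi> < f 0" using assms by (simp add: f0 frac_less2)
  have "eventually (\<lambda>n. f (real n) < 1 / \<psi>) sequentially"
    using lim0 assms(1) by (intro order_tendstoD) auto
  then obtain n where n: "f (real n) < 1 / \<psi>" by (auto simp: eventually_sequentially)
  obtain t where t: "0 \<le> t" "f t = 1 / \<psi>"
    using IVT2'[of f "real n" "1 / \<psi>" 0, OF _ _ _ cont] n f0' by auto
  have "t \<noteq> 0" using t f0' by auto
  then have tp: "0 < t" using t by simp
  have mono: "f b < f a" if "0 \<le> a" "a < b" for a b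
    unfolding f_def
  proof (rule integral_less_AE_space)
    show "AE x in B. x / (b + x * \<phi>) < x / (a + x * \<phi>)"
      using pos
    proof eventually_elim
      case (elim x)
      then have "0 < a + x * \<phi>" using assms(2) that by (simp add: add_nonneg_pos)
      then show ?case using elim that by (intro divide_strict_left_mono) auto
    qed
  qed (use int that emeasure_space_1 in auto)
  have eq: "1 = \<psi> * f (- c) \<longleftrightarrow> f (- c) = 1 / \<psi>" for c
    using assms(1) by (auto simp: field_simps)
  show ?thesis
    unfolding f_def[symmetric] eq
  proof (intro ex1I[of _ "- t"] conjI)
    show "- t < 0" "f (- (- t)) = 1 / \<psi>" using tp t by auto
    fix c assume c: "c < 0 \<and> f (- c) = 1 / \<psi>"
    show "c = - t"
      using mono[of t "- c"] mono[of "- c" t] c t by (cases "- c < t"; cases "t < - c") auto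
  qed
qed

section \<open>Spectral distributions of sketches\<close>

text \<open>Uniform law on the real eigenvalues counted with algebraic multiplicity. It is used only for
  symmetric matrices, whose characteristic polynomial splits over the reals; for the empty matrix
  the value is arbitrary.\<close>

definition empirical_spectral_distribution :: "real mat \<Rightarrow> real measure" where
  "empirical_spectral_distribution A =
    distr (measure_pmf (pmf_of_multiset (proots (char_poly A)))) borel (\<lambda>x. x)"

text \<open>Random objects depending on the sample size \<open>n\<close> are functions of \<open>n\<close> and of the
  outcome \<open>\<omega>\<close>.\<close>

definition limiting_spectral_distribution ::
  "'w measure \<Rightarrow> (nat \<Rightarrow> 'w \<Rightarrow> real mat) \<Rightarrow> real measure \<Rightarrow> bool" where
  "limiting_spectral_distribution \<Omega> S B \<longleftrightarrow>
    (AE \<omega> in \<Omega>. weak_conv_m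
      (\<lambda>n. empirical_spectral_distribution (S n \<omega> * transpose_mat (S n \<omega>))) B)"

definition orthogonal_sketching ::
  "'w measure \<Rightarrow> (nat \<Rightarrow> nat) \<Rightarrow> (nat \<Rightarrow> 'w \<Rightarrow> real mat) \<Rightarrow> bool" where
  "orthogonal_sketching \<Omega> m S \<longleftrightarrow>
    (AE \<omega> in \<Omega>. \<forall>\<^sub>F n in sequentially. S n \<omega> * transpose_mat (S n \<omega>) = 1\<^sub>m (m n))"

section \<open>Sketched ridgeless least squares and its prediction risk\<close>

text \<open>Moore--Penrose inverse.\<close>

definition pinv :: "real mat \<Rightarrow> real mat" where
  "pinv A = (THE G. G \<in> carrier_mat (dim_col A) (dim_row A) \<and>
     A * G * A = A \<and> G * A * G = G \<and>
     transpose_mat (A * G) = A * G \<and> transpose_mat (G * A) = G * A)"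

definition sketched_estimator :: "real mat \<Rightarrow> real mat \<Rightarrow> real Matrix.vec \<Rightarrow> real Matrix.vec" where
  "sketched_estimator S X Y =
    pinv (transpose_mat X * transpose_mat S * S * X)
      *\<^sub>v (transpose_mat X *\<^sub>v (transpose_mat S *\<^sub>v (S *\<^sub>v Y)))"

text \<open>Expected squared prediction error at a new feature vector, given \<open>X\<close>, \<open>S\<close>
  and \<open>\<beta>\<close>. The noise \<open>E\<close> lives on \<open>N\<close> and the new feature vector \<open>x\<close> on
  \<open>Q\<close>, separate from the space carrying \<open>(X, S, \<beta>)\<close>; the three are thus independent and
  integrating over \<open>N\<close> and \<open>Q\<close> is the conditional expectation.\<close>

definition prediction_risk ::
  "'e measure \<Rightarrow> 'x measure \<Rightarrow> ('e \<Rightarrow> real Matrix.vec) \<Rightarrow> ('x \<Rightarrow> real Matrix.vec) \<Rightarrow>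
   real mat \<Rightarrow> real Matrix.vec \<Rightarrow> real mat \<Rightarrow> real" where
  "prediction_risk N Q E x X \<beta> S =
    (\<integral>e. (\<integral>z. (x z \<bullet> sketched_estimator S X (X *\<^sub>v \<beta> + E e) - x z \<bullet> \<beta>)\<^sup>2 \<partial>Q) \<partial>N)"

text \<open>Linear model \<open>Y = X \<beta> + E\<close> with noise variance \<open>\<sigma>\<^sup>2\<close>. The laws of
  \<open>X\<close>, \<open>\<beta>\<close> and \<open>x\<close> are left unspecified; which of them obey the limit theorem
  for the risk is the business of \<open>risk_limit_law\<close> below.\<close>

locale regression_model = Omega: prob_space \<Omega> + N: prob_space N + Q: prob_space Q
  for \<Omega> :: "'w measure" and N :: "'e measure" and Q :: "'x measure" +
  fixes \<phi> \<psi> \<sigma> :: real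
    and p m :: "nat \<Rightarrow> nat"
    and X :: "nat \<Rightarrow> 'w \<Rightarrow> real mat"
    and \<beta> :: "nat \<Rightarrow> 'w \<Rightarrow> real Matrix.vec"
    and E :: "nat \<Rightarrow> 'e \<Rightarrow> real Matrix.vec"
    and x :: "nat \<Rightarrow> 'x \<Rightarrow> real Matrix.vec"
  assumes p_ratio: "(\<lambda>n. real (p n) / real n) \<longlonglongrightarrow> \<phi>"
    and m_ratio: "(\<lambda>n. real (m n) / real n) \<longlonglongrightarrow> \<psi>"
    and X_dim: "X n \<omega> \<in> carrier_mat n (p n)"
    and \<beta>_dim: "\<beta> n \<omega> \<in> carrier_vec (p n)"
    and E_dim: "E n e \<in> carrier_vec n"
    and x_dim: "x n z \<in> carrier_vec (p n)"
    and E_meas: "i < n \<Longrightarrow> (\<lambda>e. vec_index (E n e) i) \<in> borel_measurable N"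
    and E_square_integrable: "i < n \<Longrightarrow> integrable N (\<lambda>e. (vec_index (E n e) i)\<^sup>2)"
    and E_mean: "i < n \<Longrightarrow> (\<integral>e. vec_index (E n e) i \<partial>N) = 0"
    and E_cov: "i < n \<Longrightarrow> j < n \<Longrightarrow>
      (\<integral>e. vec_index (E n e) i * vec_index (E n e) j \<partial>N) = (if i = j then \<sigma>\<^sup>2 else 0)"
    and x_meas: "i < p n \<Longrightarrow> (\<lambda>z. vec_index (x n z) i) \<in> borel_measurable Q"
    and x_square_integrable: "i < p n \<Longrightarrow> integrable Q (\<lambda>z. (vec_index (x n z) i)\<^sup>2)"

definition risk_tends_to ::
  "'w measure \<Rightarrow> 'e measure \<Rightarrow> 'x measure \<Rightarrow> (nat \<Rightarrow> 'w \<Rightarrow> real mat) \<Rightarrow>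
   (nat \<Rightarrow> 'w \<Rightarrow> real Matrix.vec) \<Rightarrow> (nat \<Rightarrow> 'e \<Rightarrow> real Matrix.vec) \<Rightarrow>
   (nat \<Rightarrow> 'x \<Rightarrow> real Matrix.vec) \<Rightarrow> (nat \<Rightarrow> 'w \<Rightarrow> real mat) \<Rightarrow> real \<Rightarrow> bool" where
  "risk_tends_to \<Omega> N Q X \<beta> E x S r \<longleftrightarrow>
    (AE \<omega> in \<Omega>. (\<lambda>n. prediction_risk N Q (E n) (x n) (X n \<omega>) (\<beta> n \<omega>) (S n \<omega>)) \<longlonglongrightarrow> r)"

text \<open>The limit theorem that identifies the limiting risk of a sketch \<open>S\<close> with the limiting
  variance at its limiting spectral distribution.\<close>

definition risk_limit_law ::
  "'w measure \<Rightarrow> 'e measure \<Rightarrow> 'x measure \<Rightarrow> real \<Rightarrow> real \<Rightarrow> real \<Rightarrow>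
   (nat \<Rightarrow> 'w \<Rightarrow> real mat) \<Rightarrow> (nat \<Rightarrow> 'w \<Rightarrow> real Matrix.vec) \<Rightarrow>
   (nat \<Rightarrow> 'e \<Rightarrow> real Matrix.vec) \<Rightarrow> (nat \<Rightarrow> 'x \<Rightarrow> real Matrix.vec) \<Rightarrow>
   (nat \<Rightarrow> 'w \<Rightarrow> real mat) \<Rightarrow> bool" where
  "risk_limit_law \<Omega> N Q \<phi> \<psi> \<sigma> X \<beta> E x S \<longleftrightarrow>
    (\<forall>B. positive_law B \<longrightarrow> limiting_spectral_distribution \<Omega> S B \<longrightarrow>
      risk_tends_to \<Omega> N Q X \<beta> E x S (limiting_variance \<phi> \<psi> \<sigma> B))"

end

theory Submission
  imports Defs
begin

text \<open>For \<open>X\<close> distributed according to \<open>B\<close> put \<open>G = \<phi> X / (\<phi> X - c0)\<close>, which takes values in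
  \<open>(0, 1)\<close>. The equation defining \<open>c0\<close> fixes the mean of \<open>G\<close> to be \<open>\<phi> / \<psi>\<close>, whereas the limiting
  variance is the increasing function \<open>I \<mapsto> \<sigma>\<^sup>2 I / (1 - I)\<close> of
  \<open>I = (\<psi> / \<phi>) E G\<^sup>2\<close>. Jensen's inequality gives \<open>I \<ge> \<phi> / \<psi>\<close>, with equality when \<open>G\<close> is constant,
  that is, when \<open>B\<close> is a point mass; and \<open>G < 1\<close> keeps \<open>I\<close> below the pole at 1.\<close>

lemma positive_law_return:
  assumes "0 < a"
  shows "positive_law (return borel a)"
proof -
  interpret prob_space "return borel a" by (rule prob_space_return) simp
  have "real_distribution (return borel a)" by unfold_locales simp
  then show ?thesis using assms by (simp add: positive_law_def AE_return)
qed

lemma c0_prop: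
  fixes \<phi> \<psi> :: real
  assumes "0 < \<psi>" "0 < \<phi>" "\<phi> * inverse \<psi> < 1" "positive_law B"
  shows "c0 \<phi> \<psi> B < 0" "1 = \<psi> * (\<integral>x. x / (- c0 \<phi> \<psi> B + x * \<phi>) \<partial>B)"
  using theI'[OF c0_ex1[OF assms]] by (simp_all add: c0_def)

lemma variance_integral_bounds:
  fixes \<phi> \<psi> :: real
  assumes "0 < \<psi>" "0 < \<phi>" "\<phi> * inverse \<psi> < 1" "positive_law B"
  defines "I \<equiv> \<psi> * (\<integral>x. x\<^sup>2 * \<phi> / (c0 \<phi> \<psi> B - x * \<phi>)\<^sup>2 \<partial>B)"
  shows "\<phi> / \<psi> \<le> I" "I < 1"
proof -
  interpret real_distribution B using assms(4) by (simp add: positive_law_def)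
  have pos: "AE x in B. 0 < x" using assms(4) by (simp add: positive_law_def)
  define c where "c = c0 \<phi> \<psi> B"
  have c: "c < 0" "1 = \<psi> * (\<integral>x. x / (- c + x * \<phi>) \<partial>B)"
    using c0_prop[OF assms(1-4)] by (simp_all add: c_def)
  define G where "G x = \<phi> * (x / (- c + x * \<phi>))" for x
  have [measurable]: "G \<in> borel_measurable B"
    unfolding G_def by measurable
  have G: "AE x in B. 0 < G x \<and> G x < 1"
    using pos
  proof eventually_elim
    case (elim x)
    then have "0 < x * \<phi>" using assms(2) by simp
    \<comment> \<open>Negativity of \<open>c\<close> makes the denominator exceed
      \<open>x * \<phi>\<close>; this keeps \<open>G x\<close> below 1.\<close>
    then have "0 < - c + x * \<phi>" "x * \<phi> < - c + x * \<phi>" using c(1) by auto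
    then show ?case using elim assms(2) by (simp add: G_def mult.commute)
  qed
  have "AE x in B. norm (G x) \<le> 1"
    using G by eventually_elim simp
  then have int: "integrable B G"
    by (rule integrable_const_bound) measurable
  have "AE x in B. norm ((G x)\<^sup>2) \<le> 1"
    using G by eventually_elim (simp add: power_le_one)
  then have int2: "integrable B (\<lambda>x. (G x)\<^sup>2)"
    by (rule integrable_const_bound) measurable
  have mean: "expectation G = \<phi> / \<psi>"
  proof -
    have "expectation G = \<phi> * (\<integral>x. x / (- c + x * \<phi>) \<partial>B)"
      unfolding G_def by (rule integral_mult_right_zero)
    then show ?thesis using c(2) assms(1) by (simp add: field_simps)
  qed
  \<comment> \<open>The numerator carries one factor \<phi> where the square of \<open>G x\<close>
    has two; this produces the prefactor \<open>\<psi> / \<phi>\<close> of \<open>I\<close>.\<close>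
  have "x\<^sup>2 * \<phi> / (c - x * \<phi>)\<^sup>2 = (G x)\<^sup>2 / \<phi>" for x
  proof -
    have "(c - x * \<phi>)\<^sup>2 = (- c + x * \<phi>)\<^sup>2" by (simp add: power2_commute)
    then show ?thesis
      using assms(2) by (simp add: G_def power_divide power_mult_distrib power2_eq_square[of \<phi>])
  qed
  then have I: "I = \<psi> / \<phi> * expectation (\<lambda>x. (G x)\<^sup>2)"
    by (simp add: I_def c_def[symmetric])
  \<comment> \<open>Jensen for the square, in the form of a nonnegative variance.\<close>
  have "0 \<le> expectation (\<lambda>x. (G x)\<^sup>2) - (expectation G)\<^sup>2"
    using variance_positive[of G] variance_eq[OF int int2] by simp
  then have "\<psi> / \<phi> * (\<phi> / \<psi>)\<^sup>2 \<le> I"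
    unfolding I mean using assms(1,2) by (intro mult_left_mono) auto
  then show "\<phi> / \<psi> \<le> I"
    using assms(1,2) by (simp add: power2_eq_square)
  \<comment> \<open>Values in (0, 1) shrink when squared, and strictness survives integration
    because \<open>B\<close> has mass 1. Scaling the mean of \<open>G\<close> by
    \<open>\<psi> / \<phi>\<close> gives exactly 1.\<close>
  have "expectation (\<lambda>x. (G x)\<^sup>2) < expectation G"
  proof (rule integral_less_AE_space[OF int2 int])
    show "AE x in B. (G x)\<^sup>2 < G x"
      using G by eventually_elim (simp add: power2_eq_square)
  qed (use emeasure_space_1 in auto)
  then have "I < \<psi> / \<phi> * (\<phi> / \<psi>)"
    unfolding I mean using assms(1,2) by (intro mult_strict_left_mono) auto
  then show "I < 1"
    using assms(1,2) by simp
qed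

text \<open>The equality case of Jensen. The defining equation solves to
  \<open>c = a * (\<phi> - \<psi>)\<close>, so the denominator becomes the square of
  \<open>\<psi> * a\<close> and \<open>a\<close> cancels: all point masses attain the same
  minimum.\<close>

lemma variance_integral_return:
  fixes \<phi> \<psi> a :: real
  assumes "0 < \<psi>" "0 < \<phi>" "\<phi> * inverse \<psi> < 1" "0 < a"
  defines "c \<equiv> c0 \<phi> \<psi> (return borel a)"
  shows "\<psi> * (\<integral>x. x\<^sup>2 * \<phi> / (c - x * \<phi>)\<^sup>2 \<partial>return borel a) = \<phi> / \<psi>"
proof -
  have c: "c < 0" "1 = \<psi> * (\<integral>x. x / (- c + x * \<phi>) \<partial>return borel a)"
    using c0_prop[OF assms(1-3) positive_law_return[OF assms(4)]] by (simp_all add: c_def)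
  have "(\<integral>x. x / (- c + x * \<phi>) \<partial>return borel a) = a / (- c + a * \<phi>)"
    by (rule integral_return) auto
  then have eq: "1 = \<psi> * (a / (a * \<phi> - c))"
    using c(2) by (metis uminus_add_conv_diff)
  have "0 < a * \<phi> - c"
    using assms(2,4) c(1) by (simp add: pos_add_strict less_diff_eq order.strict_trans)
  then have d: "a * \<phi> - c = \<psi> * a"
    using eq assms(1,4) by (simp add: field_simps)
  have "(\<integral>x. x\<^sup>2 * \<phi> / (c - x * \<phi>)\<^sup>2 \<partial>return borel a) = a\<^sup>2 * \<phi> / (c - a * \<phi>)\<^sup>2"
    by (rule integral_return) auto
  also have "\<dots> = a\<^sup>2 * \<phi> / (\<psi> * a)\<^sup>2"
    using d by (metis power2_commute)
  finally show ?thesis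
    using assms(1,4) by (simp add: power_mult_distrib power2_eq_square)
qed

lemma limiting_variance_return_le:
  fixes \<phi> \<psi> \<sigma> a :: real
  assumes "0 < \<psi>" "0 < \<phi>" "\<phi> * inverse \<psi> < 1" "0 < a" "positive_law B"
  shows "limiting_variance \<phi> \<psi> \<sigma> (return borel a) \<le> limiting_variance \<phi> \<psi> \<sigma> B"
proof -
  define I where "I = \<psi> * (\<integral>x. x\<^sup>2 * \<phi> / (c0 \<phi> \<psi> B - x * \<phi>)\<^sup>2 \<partial>B)"
  have I: "\<phi> / \<psi> \<le> I" "I < 1"
    using variance_integral_bounds[OF assms(1,2,3,5)] by (simp_all add: I_def)
  have "0 < \<phi> / \<psi>" using assms(1,2) by simp
  \<comment> \<open>From \<open>\<phi> / \<psi>\<close> to \<open>I\<close> the numerator grows and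
    the denominator shrinks, staying positive by \<open>I < 1\<close>.\<close>
  then have "\<phi> / \<psi> / (1 - \<phi> / \<psi>) \<le> I / (1 - I)"
    using I by (intro frac_le) auto
  then show ?thesis
    unfolding limiting_variance_def variance_integral_return[OF assms(1-4)] I_def[symmetric]
    by (rule mult_left_mono) simp
qed

text \<open>The identity is triangular with unit diagonal, so 1 is a root of multiplicity
  \<open>k\<close> and carries all the mass. For \<open>k = 0\<close> the multiset of roots would be
  empty and its pmf unspecified.\<close>

lemma empirical_spectral_distribution_one:
  assumes "0 < k"
  shows "empirical_spectral_distribution (1\<^sub>m k) = return borel 1"
proof -
  have "diag_mat (1\<^sub>m k :: real mat) = replicate k 1"
    by (rule nth_equalityI) (auto simp: diag_mat_def)
  then have "char_poly (1\<^sub>m k :: real mat) = [:- 1, 1:] ^ k"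
    using char_poly_upper_triangular[OF one_carrier_mat[of k] upper_triangular_one]
    by (simp add: prod_list_replicate)
  then have roots: "proots (char_poly (1\<^sub>m k :: real mat)) = replicate_mset k 1"
    by (simp only: proots_power proots_linear_factor) simp
  have ne: "replicate_mset k (1 :: real) \<noteq> {#}"
    using assms by (cases k) auto
  \<comment> \<open>A pmf supported in a singleton is the point mass there, so the multiplicity
    drops out.\<close>
  have "pmf_of_multiset (replicate_mset k (1 :: real)) = return_pmf 1"
    using set_pmf_of_multiset[OF ne] assms by (simp flip: set_pmf_subset_singleton)
  then show ?thesis
    unfolding empirical_spectral_distribution_def roots
    by (simp add: return_pmf.rep_eq distr_return)
qed

lemma weak_conv_m_eventually_const:
  assumes "\<forall>\<^sub>F n in sequentially. \<mu> n = M"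
  shows "weak_conv_m \<mu> M"
  unfolding weak_conv_m_def weak_conv_def
proof (intro allI impI tendsto_eventually)
  show "\<forall>\<^sub>F n in sequentially. cdf (\<mu> n) x = cdf M x" for x
    using assms by eventually_elim simp
qed

text \<open>Links orthogonal sketches to point masses: almost surely the spectral law equals its
  limit for all large \<open>n\<close>.\<close>

lemma limiting_spectral_distribution_orthogonal:
  assumes "orthogonal_sketching \<Omega> m S" "\<forall>\<^sub>F n in sequentially. 0 < m n"
  shows "limiting_spectral_distribution \<Omega> S (return borel 1)"
  using assms(1) unfolding orthogonal_sketching_def limiting_spectral_distribution_def
proof eventually_elim
  case (elim \<omega>)
  show ?case
  proof (rule weak_conv_m_eventually_const)
    show "\<forall>\<^sub>F n in sequentially.
        empirical_spectral_distribution (S n \<omega> * transpose_mat (S n \<omega>)) = return borel 1"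
      using elim assms(2)
      by eventually_elim (simp add: empirical_spectral_distribution_one)
  qed
qed

theorem corollary4p5:
  fixes \<phi> \<psi> \<sigma> :: real
    and \<Omega> :: "'w measure" and N :: "'e measure" and Q :: "'x measure"
  assumes "0 < \<psi>" "\<psi> < 1" "0 < \<phi>" "\<phi> * inverse \<psi> < 1" "0 < \<sigma>\<^sup>2"
  shows
    "(\<forall>a>0. positive_law (return borel a) \<and>
        (\<forall>B. positive_law B \<longrightarrow>
          limiting_variance \<phi> \<psi> \<sigma> (return borel a) \<le> limiting_variance \<phi> \<psi> \<sigma> B))
     \<and> (\<forall>p m X \<beta> E x S_orth.
        regression_model \<Omega> N Q \<phi> \<psi> \<sigma> p m X \<beta> E x \<longrightarrow>
        (\<forall>n \<omega>. S_orth n \<omega> \<in> carrier_mat (m n) n) \<longrightarrow>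
        orthogonal_sketching \<Omega> m S_orth \<longrightarrow>
        limiting_spectral_distribution \<Omega> S_orth (return borel 1) \<and>
        (\<forall>S B.
          (\<forall>n \<omega>. S n \<omega> \<in> carrier_mat (m n) n) \<longrightarrow>
          positive_law B \<longrightarrow>
          limiting_spectral_distribution \<Omega> S B \<longrightarrow>
          risk_limit_law \<Omega> N Q \<phi> \<psi> \<sigma> X \<beta> E x S_orth \<longrightarrow>
          risk_limit_law \<Omega> N Q \<phi> \<psi> \<sigma> X \<beta> E x S \<longrightarrow>
          (\<exists>r_orth r.
            risk_tends_to \<Omega> N Q X \<beta> E x S_orth r_orth \<and>
            risk_tends_to \<Omega> N Q X \<beta> E x S r \<and>
            r_orth \<le> r)))"
proof (intro conjI allI impI)
  note params = assms(1,3,4)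
  show "positive_law (return borel a)" if "0 < a" for a :: real
    using that by (rule positive_law_return)
  show "limiting_variance \<phi> \<psi> \<sigma> (return borel a) \<le> limiting_variance \<phi> \<psi> \<sigma> B"
    if "0 < a" "positive_law B" for a B
    using limiting_variance_return_le[OF params that] .
  fix p m X \<beta> E x S_orth
  assume model: "regression_model \<Omega> N Q \<phi> \<psi> \<sigma> p m X \<beta> E x"
    and orth: "orthogonal_sketching \<Omega> m S_orth"
  interpret regression_model \<Omega> N Q \<phi> \<psi> \<sigma> p m X \<beta> E x by (rule model)
  \<comment> \<open>The positive limit \<psi> rules out empty sketches for large \<open>n\<close>,
    whose spectral law would be arbitrary.\<close>
  have "\<forall>\<^sub>F n in sequentially. 0 < real (m n) / real n"
    using m_ratio assms(1) by (rule order_tendstoD)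
  then have "\<forall>\<^sub>F n in sequentially. 0 < m n"
    by eventually_elim (auto simp: zero_less_divide_iff)
  then show lsd: "limiting_spectral_distribution \<Omega> S_orth (return borel 1)"
    using orth by (rule limiting_spectral_distribution_orthogonal[rotated])
  fix S B
  assume B: "positive_law B" "limiting_spectral_distribution \<Omega> S B"
    and laws: "risk_limit_law \<Omega> N Q \<phi> \<psi> \<sigma> X \<beta> E x S_orth"
      "risk_limit_law \<Omega> N Q \<phi> \<psi> \<sigma> X \<beta> E x S"
  \<comment> \<open>The witnesses are the limiting variances at the two spectral laws. The assumed
    limit theorem thereby turns the inequality between variances into one between risks.\<close>
  have "risk_tends_to \<Omega> N Q X \<beta> E x S_orth (limiting_variance \<phi> \<psi> \<sigma> (return borel 1))"
    using laws(1) lsd positive_law_return[of 1] by (simp add: risk_limit_law_def)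
  moreover have "risk_tends_to \<Omega> N Q X \<beta> E x S (limiting_variance \<phi> \<psi> \<sigma> B)"
    using laws(2) B by (simp add: risk_limit_law_def)
  moreover have "limiting_variance \<phi> \<psi> \<sigma> (return borel 1) \<le> limiting_variance \<phi> \<psi> \<sigma> B"
    using limiting_variance_return_le[OF params _ B(1)] by simp
  ultimately show "\<exists>r_orth r. risk_tends_to \<Omega> N Q X \<beta> E x S_orth r_orth \<and>
      risk_tends_to \<Omega> N Q X \<beta> E x S r \<and> r_orth \<le> r"
    by blast
qed

end
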